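(* Let $h:\mathbb{R}^d\to[K]$ be a classifier that is scale-invariant, i.e. $h(\lambda z)=h(z)$ for all $\lambda>0$ and $z\in\mathbb{R}^d$. Let $x_{\mathrm{adv}}=x+\epsilon_{\mathrm{adv}}\in\mathbb{R}^d$ be an adversarial example with perturbation $\epsilon_{\mathrm{adv}}$. Let $\beta(t)=\beta_{\min}+(\beta_{\max}-\beta_{\min})t>0$ for $t\in[0,1]$, and let $\alpha(t)=\exp\left(-\int_0^t\beta(s)\,ds\right)$. Suppose there exist $\underline{p_1},\overline{p_2}$ and $k_1\in[K]$ such that for all $t\in[0,1]$ $$\mathbb{P}\big(h(x+\epsilon'(t))=k_1\big)\ \ge\ \underline{p_1}\ >\ \overline{p_2}\ \ge\ \max_{k\ne k_1}\mathbb{P}\big(h(x+\epsilon'(t))=k\big),\qquad \epsilon'(t)\sim\mathcal{N}\Big(0,\tfrac{1-\alpha(t)}{\alpha(t)}I_d\Big).$$ With $\Phi^{-1}$ the inverse of the standard Gaussian distribution function, define $$M=\log\left(1+\left(\frac{2\|\epsilon_{\mathrm{adv}}\|_2}{\Phi^{-1}(\underline{p_1})-\Phi^{-1}(\overline{p_2})}\right)^2\right),\qquad t_{\min}=\frac{2M}{\sqrt{\beta_{\min}^2+2(\beta_{\max}-\beta_{\min})M}+\beta_{\min}},$$ and let $\beta_{\min}\ge M$ (so that $t_{\min}\le 1$). Let $$x(t)=\sqrt{\alpha(t)}\,x_{\mathrm{adv}}+\sqrt{1-\alpha(t)}\,\epsilon,\qquad \epsilon\sim\mathcal{N}(0,I_d),$$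 be constructed under the coupling in which the same Gaussian noise $\epsilon$ is shared by all times $t$. Assume that the vision encoder $\varphi:\mathbb{R}^d\to\mathbb{R}^m$ is $L$-Lipschitz for $t\ge t_{\min}$, in the sense that $$\|\varphi(x(t))-\varphi(x(t'))\|_2\le L\,\|x(t)-x(t')\|_2\qquad\text{for all } t,t'\ge t_{\min}.$$ Then for small $\delta>0$, $$\mathbb{E}\big[\|\varphi(x(t))-\varphi(x(t+\delta))\|_2\big]=O\left(L\cdot\delta\cdot\beta(t)\sqrt{\frac{\alpha(t)}{1-\alpha(t)}}\right)\qquad\text{for } t\in[t_{\min},1-\delta].$$ Moreover, for the linear noise schedule $\beta(t)=\beta_{\min}+(\beta_{\max}-\beta_{\min})t$ with $\beta_{\min}>0$ and $\beta_{\max}>\beta_{\min}$, the quantity $\beta(t)\cdot\sqrt{\frac{\alpha(t)}{1-\alpha(t)}}$ is strictly decreasing for all $t\in[t_{\min},1)$.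
   Context: $[K]=\{1,\dots,K\}$. The process $x(t)$ has the marginals of the variance-preserving forward diffusion $dx(t)=-\tfrac12\beta(t)x(t)\,dt+\sqrt{\beta(t)}\,dw(t)$, $x(0)=x_{\mathrm{adv}}$, where $w$ is a standard Wiener process. $\varphi$ is the vision encoder of a CLIP-type model with text encoder $\psi:\mathbb{R}^{d'}\to\mathbb{R}^m$. The classifier $h$ is the associated zero-shot classifier, whose logit for class $k$ at an image $z$ is the cosine similarity between $\varphi(z)$ and the embedding $\psi(\tau_k)$ of the text prompt $\tau_k$ of class $k$. *)

theory Defs
  imports "HOL-Probability.Probability"
begin

definition std_gaussian :: "(real ^ 'n) measure" where
  "std_gaussian = density lborel (\<lambda>v. \<Prod>i\<in>UNIV. ennreal (std_normal_density (v $ i)))"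

text \<open>
  \<open>iso_gaussian s\<close> is \<open>N(0, s I)\<close>, defined as the law of \<open>sqrt s\<close> times a standard
  Gaussian vector so that the degenerate variance \<open>s = 0\<close> (point mass at the origin) is included.
\<close>

definition iso_gaussian :: "real \<Rightarrow> (real ^ 'n) measure" where
  "iso_gaussian s = distr std_gaussian borel (\<lambda>v. sqrt s *\<^sub>R v)"

text \<open>
  Inverse of the standard normal distribution function, with the limiting values
  \<open>-\<infinity>\<close> and \<open>\<infinity>\<close> at the probabilities 0 and 1.
\<close>

definition std_normal_quantile :: "real \<Rightarrow> ereal" where
  "std_normal_quantile p =
     (if p \<le> 0 then - \<infinity> else if p \<ge> 1 then \<infinity>
      else ereal (inv (cdf std_normal_distribution) p))"

definition lin_sched :: "real \<Rightarrow> real \<Rightarrow> real \<Rightarrow> real" where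
  "lin_sched \<beta>min \<beta>max t = \<beta>min + (\<beta>max - \<beta>min) * t"

definition alpha :: "real \<Rightarrow> real \<Rightarrow> real \<Rightarrow> real" where
  "alpha \<beta>min \<beta>max t = exp (- integral {0..t} (lin_sched \<beta>min \<beta>max))"

definition diffused :: "real \<Rightarrow> real \<Rightarrow> real ^ 'n \<Rightarrow> real ^ 'n \<Rightarrow> real \<Rightarrow> real ^ 'n" where
  "diffused \<beta>min \<beta>max x\<^sub>0 e t =
     sqrt (alpha \<beta>min \<beta>max t) *\<^sub>R x\<^sub>0 + sqrt (1 - alpha \<beta>min \<beta>max t) *\<^sub>R e"

definition smoothing_margin ::
  "(real ^ 'n \<Rightarrow> nat) \<Rightarrow> nat \<Rightarrow> real ^ 'n \<Rightarrow> real \<Rightarrow> real \<Rightarrow> nat \<Rightarrow> real \<Rightarrow> real \<Rightarrow> bool" where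
  "smoothing_margin h K x \<beta>min \<beta>max k\<^sub>1 p\<^sub>1 p\<^sub>2 \<longleftrightarrow>
     (\<forall>t\<in>{0..1}. let N = iso_gaussian ((1 - alpha \<beta>min \<beta>max t) / alpha \<beta>min \<beta>max t) in
        \<P>(e in N. h (x + e) = k\<^sub>1) \<ge> p\<^sub>1 \<and>
        (\<forall>k\<in>{1..K} - {k\<^sub>1}. \<P>(e in N. h (x + e) = k) \<le> p\<^sub>2))"

text \<open>
  The extended quotient is finite for \<open>p\<^sub>2 < p\<^sub>1\<close>; it is 0 if one of the two
  quantiles is infinite.
\<close>

definition M_const :: "real ^ 'n \<Rightarrow> real \<Rightarrow> real \<Rightarrow> real" where
  "M_const e\<^sub>a\<^sub>d\<^sub>v p\<^sub>1 p\<^sub>2 =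
     ln (1 + (real_of_ereal (ereal (2 * norm e\<^sub>a\<^sub>d\<^sub>v) /
                 (std_normal_quantile p\<^sub>1 - std_normal_quantile p\<^sub>2)))\<^sup>2)"

definition t_min :: "real \<Rightarrow> real \<Rightarrow> real \<Rightarrow> real" where
  "t_min \<beta>min \<beta>max M = 2 * M / (sqrt (\<beta>min\<^sup>2 + 2 * (\<beta>max - \<beta>min) * M) + \<beta>min)"

text \<open>
  The rate \<open>\<beta>(t) sqrt (\<alpha>(t) / (1 - \<alpha>(t)))\<close>. It is extended-valued because of \<open>t = 0\<close>, where
  \<open>\<alpha>(t) = 1\<close> and the rate is \<open>\<infinity>\<close>, whereas real division would yield 0. This time is in range
  exactly if \<open>t_min\<close> vanishes, for instance for a zero perturbation.
\<close>

definition rate :: "real \<Rightarrow> real \<Rightarrow> real \<Rightarrow> ereal" where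
  "rate \<beta>min \<beta>max t =
     (let a = alpha \<beta>min \<beta>max t in
      if a = 1 then \<infinity> else ereal (lin_sched \<beta>min \<beta>max t * sqrt (a / (1 - a))))"

definition cos_sim :: "real ^ 'm \<Rightarrow> real ^ 'm \<Rightarrow> real" where
  "cos_sim u v = (u \<bullet> v) / (norm u * norm v)"

text \<open>Ties between maximal logits may be broken arbitrarily.\<close>

definition zero_shot_classifier ::
  "(real ^ 'n \<Rightarrow> nat) \<Rightarrow> nat \<Rightarrow> (real ^ 'n \<Rightarrow> real ^ 'm) \<Rightarrow> (real ^ 'd \<Rightarrow> real ^ 'm)
     \<Rightarrow> (nat \<Rightarrow> real ^ 'd) \<Rightarrow> bool" where
  "zero_shot_classifier h K \<phi> \<psi> \<tau> \<longleftrightarrow>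
     (\<forall>z. h z \<in> {1..K} \<and>
          (\<forall>k\<in>{1..K}. cos_sim (\<phi> z) (\<psi> (\<tau> k)) \<le> cos_sim (\<phi> z) (\<psi> (\<tau> (h z)))))"

end

theory Submission
  imports Defs
begin

text \<open>
  Both claims become elementary inequalities in the integrated schedule
  \<open>B(t) = \<integral>\<^sub>0\<^sup>t \<beta>\<close>, where \<open>\<alpha> = exp (- B)\<close>. Under the shared noise, \<open>x(t) - x(t')\<close> has coefficients
  \<open>\<surd>\<alpha> - \<surd>\<alpha>'\<close> and \<open>\<surd>(1 - \<alpha>) - \<surd>(1 - \<alpha>')\<close>, both at most \<open>(B' - B) \<surd>(\<alpha> / (1 - \<alpha>))\<close>, and \<open>B' - B\<close> is at
  most \<open>2 \<delta> \<beta>(t)\<close> once \<open>\<delta>\<close> is small compared with the slope of the schedule. For the monotonicity,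
  \<open>\<beta>\<^sup>2 = \<beta>\<^sub>m\<^sub>i\<^sub>n\<^sup>2 + 2 \<beta>' B\<close> is affine in \<open>B\<close>, so the squared rate is \<open>(\<beta>\<^sub>m\<^sub>i\<^sub>n\<^sup>2 + 2 \<beta>' B) / (exp B - 1)\<close>, which decreases
  in \<open>B\<close> because \<open>(exp B - 1) / B\<close> increases.
\<close>

section \<open>The integrated schedule and the starting time\<close>

definition sched_int :: "real \<Rightarrow> real \<Rightarrow> real \<Rightarrow> real" where
  "sched_int b m t = b * t + (m - b) * t\<^sup>2 / 2"

lemma alpha_eq_exp:
  assumes "t \<ge> 0"
  shows "alpha b m t = exp (- sched_int b m t)"
proof -
  have "(sched_int b m has_vector_derivative lin_sched b m u) (at u within {0..t})" for u
    unfolding sched_int_def lin_sched_def has_real_derivative_iff_has_vector_derivative[symmetric]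
    by (auto intro!: derivative_eq_intros simp: field_simps)
  then have "(lin_sched b m has_integral (sched_int b m t - sched_int b m 0)) {0..t}"
    using assms by (intro fundamental_theorem_of_calculus) auto
  then show ?thesis
    by (simp add: alpha_def integral_unique sched_int_def)
qed

lemma sched_int_diff:
  "sched_int b m (t + d) - sched_int b m t = d * (lin_sched b m t + (m - b) * d / 2)"
  by (simp add: sched_int_def lin_sched_def power2_eq_square field_simps)

text \<open>Constant slope gives the analogue of \<open>v^2 = v0^2 + 2 a s\<close> for uniform
  acceleration: time is eliminated, so the squared rate becomes a function of the integrated
  schedule alone.\<close>

lemma lin_sched_square: "(lin_sched b m t)\<^sup>2 = b\<^sup>2 + 2 * (m - b) * sched_int b m t"
  by (simp add: sched_int_def lin_sched_def power2_eq_square field_simps)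

text \<open>The midpoint rule is exact for an affine schedule, and the midpoint stays in [0,1].
  Hence positivity there suffices, also for a decreasing schedule.\<close>

lemma sched_int_less:
  assumes "\<forall>t\<in>{0..1}. lin_sched b m t > 0" "0 \<le> s" "s < t" "t \<le> 1"
  shows "sched_int b m s < sched_int b m t"
proof -
  have "sched_int b m t - sched_int b m s = (t - s) * lin_sched b m ((s + t) / 2)"
    by (simp add: sched_int_def lin_sched_def power2_eq_square field_simps)
  moreover have "lin_sched b m ((s + t) / 2) > 0"
    using assms by auto
  ultimately show ?thesis
    using assms(3) by (smt (verit) mult_pos_pos)
qed

lemma sched_int_0 [simp]: "sched_int b m 0 = 0"
  by (simp add: sched_int_def)

lemma rate_0: "rate b m 0 = \<infinity>"
  by (simp add: rate_def alpha_eq_exp)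

lemma rate_eq:
  assumes "t \<ge> 0" "sched_int b m t > 0"
  shows "rate b m t = ereal (lin_sched b m t * sqrt (alpha b m t / (1 - alpha b m t)))"
  using assms by (simp add: rate_def alpha_eq_exp Let_def)

lemma M_const_nonneg: "M_const e p q \<ge> 0"
  by (simp add: M_const_def)

text \<open>When \<open>m < b\<close> the radicand may be negative. It is still at least
  \<open>- b\<^sup>2\<close>, and \<open>sqrt\<close> is odd in HOL, so the root is at least
  \<open>- b\<close> and the denominator is nonnegative. A zero denominator yields the value
  0.\<close>

lemma t_min_nonneg:
  assumes "0 \<le> M" "M \<le> b" "0 \<le> m"
  shows "0 \<le> t_min b m M"
proof -
  have "b * M \<le> b\<^sup>2"
    using assms by (simp add: power2_eq_square mult_left_mono)
  moreover have "0 \<le> m * M"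
    using assms by simp
  ultimately have "- (b\<^sup>2) \<le> b\<^sup>2 + 2 * (m - b) * M"
    by (simp add: algebra_simps)
  then have "sqrt (- (b\<^sup>2)) \<le> sqrt (b\<^sup>2 + 2 * (m - b) * M)"
    by (rule real_sqrt_le_mono)
  then have "0 \<le> sqrt (b\<^sup>2 + 2 * (m - b) * M) + b"
    using assms by (simp add: real_sqrt_minus)
  then show ?thesis
    using assms by (simp add: t_min_def)
qed

section \<open>Strict decrease of the rate\<close>

lemma exp_minus_one_slope_mono:
  fixes u v :: real
  assumes "0 \<le> u" "u \<le> v"
  shows "(exp u - 1) * v \<le> (exp v - 1) * u"
proof (cases "v = 0")
  case False
  then have v: "v > 0"
    using assms by simp
  have "convex_on UNIV (exp :: real \<Rightarrow> real)"
    by (rule exp_convex)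
  \<comment> \<open>The chord of exp from 0 to \<open>v\<close> lies above its graph at
    \<open>u = (u / v) * v\<close>, so the slope of the chord from 0 grows with its right
    end.\<close>
  then have "exp ((1 - u / v) *\<^sub>R 0 + (u / v) *\<^sub>R v) \<le> (1 - u / v) * exp 0 + (u / v) * exp v"
    using assms v by (intro convex_onD) auto
  then have "exp u - 1 \<le> (exp v - 1) * u / v"
    using v by (simp add: algebra_simps diff_divide_distrib)
  then show ?thesis
    using v by (simp only: pos_le_divide_eq)
qed (use assms in auto)

text \<open>After cross-multiplication the \<open>c\<close> terms are ordered weakly by the chord
  slopes of exp, and the \<open>a\<close> terms strictly by its monotonicity. Strictness thus comes
  from \<open>a > 0\<close>.\<close>

lemma affine_over_exp_minus_one_strict_antimono:
  fixes a c u v :: real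
  assumes "a > 0" "c \<ge> 0" "0 < u" "u < v"
  shows "(a + c * v) / (exp v - 1) < (a + c * u) / (exp u - 1)"
proof -
  have "c * ((exp u - 1) * v) \<le> c * ((exp v - 1) * u)"
    using assms by (intro mult_left_mono exp_minus_one_slope_mono) auto
  moreover have "a * (exp u - 1) < a * (exp v - 1)"
    using assms by simp
  ultimately have "(a + c * v) * (exp u - 1) < (a + c * u) * (exp v - 1)"
    by (simp add: algebra_simps)
  then show ?thesis
    using assms by (simp add: divide_simps mult.commute)
qed

lemma rate_strict_antimono:
  assumes "b > 0" "m > b"
  shows "strict_antimono_on {0..} (rate b m)"
proof (rule monotone_onI)
  fix s t :: real
  assume st: "s \<in> {0..}" "t \<in> {0..}" "s < t"
  have pos: "sched_int b m u > 0" if "u > 0" for u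
    using that assms by (simp add: sched_int_def add_pos_nonneg)
  \<comment> \<open>The schedule is nonnegative, hence the root of its square, and can be moved
    under the square root together with \<alpha> / (1 - \<alpha>) = 1 / (exp B - 1).\<close>
  have eq: "rate b m u = ereal (sqrt ((b\<^sup>2 + 2 * (m - b) * sched_int b m u) / (exp (sched_int b m u) - 1)))"
    if "u > 0" for u
  proof -
    have "lin_sched b m u \<ge> 0"
      using that assms by (simp add: lin_sched_def)
    moreover have "alpha b m u / (1 - alpha b m u) = 1 / (exp (sched_int b m u) - 1)"
      using that pos[OF that] by (simp add: alpha_eq_exp exp_minus field_simps)
    ultimately show ?thesis
      using that pos[OF that]
      by (simp add: rate_eq real_sqrt_divide flip: lin_sched_square del: right_diff_distrib_numeral)
  qed
  show "rate b m t < rate b m s"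
  proof (cases "s = 0")
    case True
    then show ?thesis
      using st by (simp add: rate_0 eq)
  next
    case False
    \<comment> \<open>The midpoint identity again, now without the bound 1 on the times: for
      \<open>0 < b < m\<close> the schedule is positive on the whole half-line.\<close>
    have "sched_int b m t - sched_int b m s = (t - s) * (b + (m - b) * (s + t) / 2)"
      by (simp add: sched_int_def power2_eq_square field_simps)
    moreover have "b + (m - b) * (s + t) / 2 > 0"
      using st assms by (intro add_pos_nonneg) auto
    ultimately have "sched_int b m s < sched_int b m t"
      using st by (smt (verit) mult_pos_pos)
    then show ?thesis
      using False st assms pos[of s]
      by (simp add: eq affine_over_exp_minus_one_strict_antimono)
  qed
qed

section \<open>Pathwise bound on the increments under shared noise\<close>

lemma exp_neg_diff_le:
  fixes u v :: real
  shows "exp (- u) - exp (- v) \<le> exp (- u) * (v - u)"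
proof -
  have "exp (- v) = exp (- u) * exp (- (v - u))"
    by (simp add: exp_add[symmetric])
  moreover have "1 - (v - u) \<le> exp (- (v - u))"
    using exp_ge_add_one_self[of "- (v - u)"] by linarith
  then have "exp (- u) * (1 - (v - u)) \<le> exp (- u) * exp (- (v - u))"
    by (rule mult_left_mono) simp
  ultimately show ?thesis
    by (simp add: algebra_simps)
qed

text \<open>Both bounds rest on the tangent inequality \<open>exp_neg_diff_le\<close>. The root of
  \<open>exp (- u)\<close> is again an exponential, with halved exponent; the difference of the
  roots of \<open>1 - exp (- u)\<close> and \<open>1 - exp (- v)\<close> is rationalised
  first.\<close>

lemma sqrt_exp_coefficients_diff:
  fixes u v :: real
  assumes "0 < u" "u \<le> v"
  defines "r \<equiv> sqrt (exp (- u) / (1 - exp (- u)))"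
  shows "\<bar>sqrt (exp (- u)) - sqrt (exp (- v))\<bar> \<le> r * (v - u)"
    and "\<bar>sqrt (1 - exp (- u)) - sqrt (1 - exp (- v))\<bar> \<le> r * (v - u)"
proof -
  define a a' where "a = exp (- u)" and "a' = exp (- v)"
  have a: "0 < a" "a < 1" "a' \<le> a" "0 < a'"
    using assms by (auto simp: a_def a'_def)
  have r: "r = sqrt a / sqrt (1 - a)"
    by (simp add: r_def a_def real_sqrt_divide)
  have s: "0 < sqrt a" "sqrt a < 1" "0 < sqrt (1 - a)" "sqrt (1 - a) \<le> 1"
    using a by auto
  have exp_half: "sqrt (exp (- w)) = exp (- (w / 2))" for w :: real
    by (intro real_sqrt_unique) (auto simp: power2_eq_square exp_add[symmetric])
  have "sqrt a - sqrt a' \<le> sqrt a * (v / 2 - u / 2)"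
    unfolding a_def a'_def exp_half by (rule exp_neg_diff_le)
  also have "\<dots> \<le> sqrt a * (v - u)"
    using assms s by (intro mult_left_mono) auto
  \<comment> \<open>Since \<open>sqrt (1 - a) \<le> 1\<close>, dividing by it only enlarges
    \<open>sqrt a\<close>.\<close>
  also have "\<dots> \<le> r * (v - u)"
    using s assms(2) mult_left_mono[of "sqrt (1 - a)" 1 "sqrt a"] unfolding r
    by (intro mult_right_mono) (simp_all add: pos_le_divide_eq)
  finally show "\<bar>sqrt (exp (- u)) - sqrt (exp (- v))\<bar> \<le> r * (v - u)"
    using a by (simp add: a_def a'_def)
  \<comment> \<open>Adding \<open>sqrt (1 - a')\<close> to the second factor produces a difference
    of squares. Dividing by \<open>sqrt (1 - a)\<close> at the end supplies the denominator of
    \<open>r\<close>.\<close>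
  have "(sqrt (1 - a') - sqrt (1 - a)) * sqrt (1 - a) \<le>
      (sqrt (1 - a') - sqrt (1 - a)) * (sqrt (1 - a') + sqrt (1 - a))"
    using a by (intro mult_left_mono) auto
  also have "\<dots> = a - a'"
    using a by (simp add: algebra_simps)
  also have "\<dots> \<le> a * (v - u)"
    unfolding a_def a'_def by (rule exp_neg_diff_le)
  also have "\<dots> \<le> sqrt a * (v - u)"
    using s a assms by (intro mult_right_mono) (auto intro!: real_le_rsqrt simp: power2_eq_square mult_left_le)
  finally have "sqrt (1 - a') - sqrt (1 - a) \<le> r * (v - u)"
    using s by (simp add: r field_simps)
  then show "\<bar>sqrt (1 - exp (- u)) - sqrt (1 - exp (- v))\<bar> \<le> r * (v - u)"
    using a by (simp add: a_def a'_def)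
qed

lemma norm_diffused_diff_le:
  assumes pos: "\<forall>t\<in>{0..1}. lin_sched b m t > 0"
    and t: "0 < t" "t + d \<le> 1" and d: "0 < d" "(m - b) * d \<le> 2 * lin_sched b m t"
  shows "norm (diffused b m z e t - diffused b m z e (t + d)) \<le>
    2 * d * lin_sched b m t * sqrt (alpha b m t / (1 - alpha b m t)) * (norm z + norm e)"
proof -
  define u v where "u = sched_int b m t" and "v = sched_int b m (t + d)"
  define r where "r = sqrt (exp (- u) / (1 - exp (- u)))"
  have uv: "0 < u" "u < v"
    using sched_int_less[OF pos, of 0 t] sched_int_less[OF pos, of t "t + d"] t d
    by (auto simp: u_def v_def)
  have al: "alpha b m t = exp (- u)" "alpha b m (t + d) = exp (- v)"
    using t d by (auto simp: u_def v_def alpha_eq_exp)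
  have "r \<ge> 0"
    using uv by (simp add: r_def)
  \<comment> \<open>The smallness condition on \<open>d\<close> lets the quadratic part of the
    increment be absorbed into its linear part \<open>d * lin_sched b m t\<close>; this is the
    origin of the factor 2.\<close>
  have "d * ((m - b) * d / 2) \<le> d * lin_sched b m t"
    using d by (intro mult_left_mono) auto
  then have vu: "v - u \<le> 2 * d * lin_sched b m t"
    unfolding u_def v_def sched_int_diff by (simp add: algebra_simps)
  have "diffused b m z e t - diffused b m z e (t + d) =
      (sqrt (exp (- u)) - sqrt (exp (- v))) *\<^sub>R z + (sqrt (1 - exp (- u)) - sqrt (1 - exp (- v))) *\<^sub>R e"
    by (simp only: diffused_def al scaleR_diff_left) simp
  also have "norm \<dots> \<le> \<bar>sqrt (exp (- u)) - sqrt (exp (- v))\<bar> * norm z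
      + \<bar>sqrt (1 - exp (- u)) - sqrt (1 - exp (- v))\<bar> * norm e"
    by (rule order_trans[OF norm_triangle_ineq]) simp
  also have "\<dots> \<le> (r * (v - u)) * norm z + (r * (v - u)) * norm e"
    unfolding r_def using uv
    by (intro add_mono mult_right_mono sqrt_exp_coefficients_diff) auto
  also have "\<dots> = (v - u) * (r * (norm z + norm e))"
    by (simp add: algebra_simps)
  also have "\<dots> \<le> 2 * d * lin_sched b m t * (r * (norm z + norm e))"
    using vu \<open>r \<ge> 0\<close> by (intro mult_right_mono) auto
  finally show ?thesis
    by (simp add: r_def al mult.assoc)
qed

section \<open>First moment of the Gaussian noise\<close>

lemma Basis_vec_real: "(Basis :: (real ^ 'n) set) = range (\<lambda>i. axis i 1)"
  by (auto simp: Basis_vec_def)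

text \<open>Tonelli's theorem transported from factors indexed by \<open>Basis\<close> to factors
  indexed by coordinates, along the injection of \<open>i\<close> to
  \<open>axis i 1\<close>.\<close>

lemma nn_integral_lborel_vec_prod:
  fixes f :: "'n::finite \<Rightarrow> real \<Rightarrow> ennreal"
  assumes [measurable]: "\<And>i. f i \<in> borel_measurable borel"
  shows "(\<integral>\<^sup>+v. (\<Prod>i\<in>UNIV. f i (v $ i)) \<partial>(lborel :: (real ^ 'n) measure)) =
    (\<Prod>i\<in>UNIV. \<integral>\<^sup>+y. f i y \<partial>lborel)"
proof -
  let ?ax = "\<lambda>i. axis i 1 :: real ^ 'n"
  define g where "g = (\<lambda>b. f (inv ?ax b))"
  have inj: "inj ?ax"
    by (auto simp: inj_on_def axis_eq_axis)
  have [simp]: "g (?ax i) = f i" for i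
    by (simp add: g_def inv_f_f[OF inj])
  have "(\<integral>\<^sup>+v. (\<Prod>i\<in>UNIV. f i (v $ i)) \<partial>lborel) = (\<integral>\<^sup>+v. (\<Prod>b\<in>Basis. g b (v \<bullet> b)) \<partial>lborel)"
    unfolding Basis_vec_real prod.reindex[OF inj] by (simp add: inner_axis)
  also have "\<dots> = (\<Prod>b\<in>Basis. \<integral>\<^sup>+y. g b y \<partial>lborel)"
    by (rule nn_integral_lborel_prod) (auto simp: g_def)
  also have "\<dots> = (\<Prod>i\<in>UNIV. \<integral>\<^sup>+y. f i y \<partial>lborel)"
    unfolding Basis_vec_real prod.reindex[OF inj] by simp
  finally show ?thesis .
qed

lemma integrable_std_gaussian_component:
  "integrable std_gaussian (\<lambda>v :: real ^ 'n. v $ i)"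
proof (rule integrableI_bounded)
  show "(\<lambda>v. v $ i) \<in> borel_measurable (std_gaussian :: (real ^ 'n) measure)"
    by (simp add: std_gaussian_def)
  \<comment> \<open>The weight is the absolute value in coordinate \<open>i\<close> and 1 elsewhere,
    so the integral factors into one first absolute moment and total masses of one-dimensional
    Gaussians.\<close>
  let ?f = "\<lambda>j y. ennreal (std_normal_density y) * (if j = i then ennreal \<bar>y\<bar> else 1)"
  have abs: "integrable lborel (\<lambda>y. std_normal_density y * \<bar>y\<bar>)"
    using integrable_std_normal_moment_abs[of 1] by simp
  have fin: "(\<integral>\<^sup>+y. ?f j y \<partial>lborel) < \<infinity>" for j
  proof (cases "j = i")
    case True
    then show ?thesis
      using abs by (simp add: ennreal_mult[symmetric] integrable_iff_bounded abs_mult)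
  next
    case False
    then show ?thesis
      using integrable_std_normal_moment[of 0] by (simp add: integrable_iff_bounded)
  qed
  have "(\<integral>\<^sup>+v. ennreal (norm (v $ i)) \<partial>std_gaussian) =
      (\<integral>\<^sup>+v. (\<Prod>j\<in>UNIV. ?f j (v $ j)) \<partial>(lborel :: (real ^ 'n) measure))"
    by (simp add: std_gaussian_def nn_integral_density prod.distrib)
  also have "\<dots> = (\<Prod>j\<in>UNIV. \<integral>\<^sup>+y. ?f j y \<partial>lborel)"
    by (rule nn_integral_lborel_vec_prod) simp
  also have "\<dots> < \<infinity>"
    using fin by (simp add: ennreal_prod_eq_top flip: less_top)
  finally show "(\<integral>\<^sup>+v. ennreal (norm ((v :: real ^ 'n) $ i)) \<partial>std_gaussian) < \<infinity>" .
qed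

lemma integrable_std_gaussian_norm:
  "integrable std_gaussian (norm :: real ^ 'n \<Rightarrow> real)"
proof (rule Bochner_Integration.integrable_bound)
  show "integrable std_gaussian (\<lambda>v :: real ^ 'n. \<Sum>i\<in>UNIV. \<bar>v $ i\<bar>)"
    by (intro Bochner_Integration.integrable_sum integrable_abs integrable_std_gaussian_component)
  show "norm \<in> borel_measurable (std_gaussian :: (real ^ 'n) measure)"
    by (simp add: std_gaussian_def)
  show "AE v in std_gaussian. norm (norm (v :: real ^ 'n)) \<le> norm (\<Sum>i\<in>UNIV. \<bar>v $ i\<bar>)"
    by (simp add: norm_le_l1_cart sum_nonneg)
qed

section \<open>Expected increments and the two claims\<close>

lemma measurable_diffused [measurable]:
  assumes "e \<in> borel_measurable \<Omega>"
  shows "(\<lambda>\<omega>. diffused b m z (e \<omega>) t) \<in> borel_measurable \<Omega>"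
  using assms unfolding diffused_def by simp

lemma integrable_diffused:
  assumes "finite_measure \<Omega>" "e \<in> borel_measurable \<Omega>" "integrable \<Omega> (\<lambda>\<omega>. norm (e \<omega>))"
  shows "integrable \<Omega> (\<lambda>\<omega>. diffused b m z (e \<omega>) t)"
proof -
  have "integrable \<Omega> e"
    using assms by (simp add: integrable_norm_iff)
  then show ?thesis
    using assms(1) unfolding diffused_def
    by (intro Bochner_Integration.integrable_add integrable_scaleR_right finite_measure.integrable_const)
qed

theorem theorem2:
  fixes x e\<^sub>a\<^sub>d\<^sub>v x\<^sub>a\<^sub>d\<^sub>v :: "real ^ 'd"
    and h :: "real ^ 'd \<Rightarrow> nat" and K k\<^sub>1 :: nat
    and \<psi> :: "real ^ 'e \<Rightarrow> real ^ 'm" and \<tau> :: "nat \<Rightarrow> real ^ 'e"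
    and p\<^sub>1 p\<^sub>2 M :: real
    and \<Omega> :: "'w measure" and \<epsilon> :: "'w \<Rightarrow> real ^ 'd"
  assumes x_adv: "x\<^sub>a\<^sub>d\<^sub>v = x + e\<^sub>a\<^sub>d\<^sub>v"
    and h_range: "\<And>z. h z \<in> {1..K}"
    and h_measurable: "h \<in> borel \<rightarrow>\<^sub>M count_space UNIV"
    and h_scale: "\<And>c z. c > 0 \<Longrightarrow> h (c *\<^sub>R z) = h z"
    and k1: "k\<^sub>1 \<in> {1..K}"
    and p: "p\<^sub>1 > p\<^sub>2"
    and M: "M = M_const e\<^sub>a\<^sub>d\<^sub>v p\<^sub>1 p\<^sub>2"
    and Omega: "prob_space \<Omega>"
    and noise: "\<epsilon> \<in> borel_measurable \<Omega>" "distr \<Omega> borel \<epsilon> = std_gaussian"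
  shows "(\<exists>C>0. \<forall>\<beta>min \<beta>max L. \<forall>\<phi> :: real ^ 'd \<Rightarrow> real ^ 'm.
            (\<forall>t\<in>{0..1}. lin_sched \<beta>min \<beta>max t > 0) \<and>
            smoothing_margin h K x \<beta>min \<beta>max k\<^sub>1 p\<^sub>1 p\<^sub>2 \<and>
            \<beta>min \<ge> M \<and>
            \<phi> \<in> borel_measurable borel \<and>
            zero_shot_classifier h K \<phi> \<psi> \<tau> \<and>
            L \<ge> 0 \<and>
            (\<forall>t\<in>{t_min \<beta>min \<beta>max M..1}. \<forall>t'\<in>{t_min \<beta>min \<beta>max M..1}. AE \<omega> in \<Omega>.
               norm (\<phi> (diffused \<beta>min \<beta>max x\<^sub>a\<^sub>d\<^sub>v (\<epsilon> \<omega>) t) - \<phi> (diffused \<beta>min \<beta>max x\<^sub>a\<^sub>d\<^sub>v (\<epsilon> \<omega>) t'))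
               \<le> L * norm (diffused \<beta>min \<beta>max x\<^sub>a\<^sub>d\<^sub>v (\<epsilon> \<omega>) t - diffused \<beta>min \<beta>max x\<^sub>a\<^sub>d\<^sub>v (\<epsilon> \<omega>) t'))
            \<longrightarrow>
            (\<exists>\<delta>\<^sub>0>0. \<forall>\<delta>\<in>{0<..<\<delta>\<^sub>0}. \<forall>t\<in>{t_min \<beta>min \<beta>max M..1 - \<delta>}.
               integrable \<Omega> (\<lambda>\<omega>. norm (\<phi> (diffused \<beta>min \<beta>max x\<^sub>a\<^sub>d\<^sub>v (\<epsilon> \<omega>) t)
                                    - \<phi> (diffused \<beta>min \<beta>max x\<^sub>a\<^sub>d\<^sub>v (\<epsilon> \<omega>) (t + \<delta>)))) \<and>
               ereal (prob_space.expectation \<Omega>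
                        (\<lambda>\<omega>. norm (\<phi> (diffused \<beta>min \<beta>max x\<^sub>a\<^sub>d\<^sub>v (\<epsilon> \<omega>) t)
                             - \<phi> (diffused \<beta>min \<beta>max x\<^sub>a\<^sub>d\<^sub>v (\<epsilon> \<omega>) (t + \<delta>)))))
               \<le> ereal (C * (L * \<delta>)) * rate \<beta>min \<beta>max t)) \<and>
         (\<forall>\<beta>min \<beta>max.
            smoothing_margin h K x \<beta>min \<beta>max k\<^sub>1 p\<^sub>1 p\<^sub>2 \<and> \<beta>min \<ge> M \<and>
            \<beta>min > 0 \<and> \<beta>max > \<beta>min
            \<longrightarrow> strict_antimono_on {t_min \<beta>min \<beta>max M..<1} (rate \<beta>min \<beta>max))"
proof -
  interpret prob_space \<Omega> by (rule Omega)
  note [measurable] = noise(1)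
  have "integrable (distr \<Omega> borel \<epsilon>) (norm :: real ^ 'd \<Rightarrow> real)"
    unfolding noise(2) by (rule integrable_std_gaussian_norm)
  then have int_norm: "integrable \<Omega> (\<lambda>\<omega>. norm (\<epsilon> \<omega>))"
    by (simp add: integrable_distr_eq)
  have M0: "M \<ge> 0"
    unfolding M by (rule M_const_nonneg)
  \<comment> \<open>The 2 is that of the pathwise bound; the summand 1 makes the constant strictly
    positive. It depends only on the starting point and the noise, hence is uniform in the schedule,
    \<open>L\<close>, \<phi>, the time and the step size.\<close>
  define C where "C = 2 * (norm x\<^sub>a\<^sub>d\<^sub>v + expectation (\<lambda>\<omega>. norm (\<epsilon> \<omega>))) + 1"
  have "expectation (\<lambda>\<omega>. norm (\<epsilon> \<omega>)) \<ge> 0"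
    by simp
  then have C: "C > 0" "2 * (norm x\<^sub>a\<^sub>d\<^sub>v + expectation (\<lambda>\<omega>. norm (\<epsilon> \<omega>))) \<le> C"
    by (auto simp: C_def add_nonneg_pos)
  have step: "integrable \<Omega> (\<lambda>\<omega>. norm (\<phi> (diffused b m x\<^sub>a\<^sub>d\<^sub>v (\<epsilon> \<omega>) t) - \<phi> (diffused b m x\<^sub>a\<^sub>d\<^sub>v (\<epsilon> \<omega>) (t + \<delta>)))) \<and>
      ereal (expectation (\<lambda>\<omega>. norm (\<phi> (diffused b m x\<^sub>a\<^sub>d\<^sub>v (\<epsilon> \<omega>) t) - \<phi> (diffused b m x\<^sub>a\<^sub>d\<^sub>v (\<epsilon> \<omega>) (t + \<delta>)))))
      \<le> ereal (C * (L * \<delta>)) * rate b m t"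
    if pos: "\<forall>t\<in>{0..1}. lin_sched b m t > 0"
      and [measurable]: "\<phi> \<in> borel_measurable borel" and L: "L \<ge> 0"
      and t: "0 \<le> t" "t + \<delta> \<le> 1"
      and d: "0 < \<delta>" "(m - b) * \<delta> \<le> 2 * lin_sched b m t"
      and lip: "AE \<omega> in \<Omega>. norm (\<phi> (diffused b m x\<^sub>a\<^sub>d\<^sub>v (\<epsilon> \<omega>) t) - \<phi> (diffused b m x\<^sub>a\<^sub>d\<^sub>v (\<epsilon> \<omega>) (t + \<delta>)))
        \<le> L * norm (diffused b m x\<^sub>a\<^sub>d\<^sub>v (\<epsilon> \<omega>) t - diffused b m x\<^sub>a\<^sub>d\<^sub>v (\<epsilon> \<omega>) (t + \<delta>))"
    for b m L t \<delta> and \<phi> :: "real ^ 'd \<Rightarrow> real ^ 'm"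
  proof -
    let ?F = "\<lambda>\<omega>. norm (\<phi> (diffused b m x\<^sub>a\<^sub>d\<^sub>v (\<epsilon> \<omega>) t) - \<phi> (diffused b m x\<^sub>a\<^sub>d\<^sub>v (\<epsilon> \<omega>) (t + \<delta>)))"
    let ?G = "\<lambda>\<omega>. norm (diffused b m x\<^sub>a\<^sub>d\<^sub>v (\<epsilon> \<omega>) t - diffused b m x\<^sub>a\<^sub>d\<^sub>v (\<epsilon> \<omega>) (t + \<delta>))"
    have G: "integrable \<Omega> ?G"
      by (intro integrable_norm Bochner_Integration.integrable_diff integrable_diffused
          finite_measure_axioms noise(1) int_norm)
    have F: "integrable \<Omega> ?F"
    \<comment> \<open>Integrability comes from domination by the diffused increment, so no moment
      bound on the encoder itself is required.\<close>
    proof (rule Bochner_Integration.integrable_bound)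
      show "integrable \<Omega> (\<lambda>\<omega>. L * ?G \<omega>)"
        using G by simp
      show "AE \<omega> in \<Omega>. norm (?F \<omega>) \<le> norm (L * ?G \<omega>)"
        using lip L by simp
    qed measurable
    have FG: "expectation ?F \<le> L * expectation ?G"
      using integral_mono_AE[OF F _ lip] G by simp
    have "ereal (expectation ?F) \<le> ereal (C * (L * \<delta>)) * rate b m t"
    proof (cases "t = 0")
      \<comment> \<open>The rate is infinite here, so the bound is trivial for \<open>L > 0\<close>.
        For \<open>L = 0\<close> the right side is \<open>0 * \<infinity> = 0\<close> in
        \<open>ereal\<close>, and \<open>FG\<close> already gives a nonpositive expectation.\<close>
      case True
      then show ?thesis
        using FG L C(1) d(1) by (cases "L = 0") (auto simp: rate_0)
    next
      case False
      then have "t > 0"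
        using t by simp
      define q where "q = lin_sched b m t * sqrt (alpha b m t / (1 - alpha b m t))"
      have rate: "rate b m t = ereal q"
        using sched_int_less[OF pos, of 0 t] \<open>t > 0\<close> t d(1) by (simp add: rate_eq q_def)
      have B: "sched_int b m t > 0"
        using sched_int_less[OF pos, of 0 t] \<open>t > 0\<close> t d(1) by simp
      have "lin_sched b m t > 0"
        using pos t d(1) by simp
      then have "q \<ge> 0"
        using B t by (simp add: q_def alpha_eq_exp)
      have "expectation ?G \<le> expectation (\<lambda>\<omega>. 2 * \<delta> * q * (norm x\<^sub>a\<^sub>d\<^sub>v + norm (\<epsilon> \<omega>)))"
        using norm_diffused_diff_le[OF pos \<open>t > 0\<close> t(2) d] int_norm
        by (intro integral_mono G) (auto simp: q_def mult.assoc)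
      also have "\<dots> = \<delta> * q * (2 * (norm x\<^sub>a\<^sub>d\<^sub>v + expectation (\<lambda>\<omega>. norm (\<epsilon> \<omega>))))"
        using int_norm by (simp add: prob_space)
      also have "\<dots> \<le> \<delta> * q * C"
        using C(2) d(1) \<open>q \<ge> 0\<close> by (intro mult_left_mono) auto
      finally have "L * expectation ?G \<le> L * (\<delta> * q * C)"
        using L by (rule mult_left_mono)
      with FG show ?thesis
        by (simp add: rate mult_ac)
    qed
    with F show ?thesis by simp
  qed
  show ?thesis
  proof (rule conjI, rule exI[of _ C], rule conjI[OF C(1)]; intro allI impI; elim conjE)
    fix b m L :: real and \<phi> :: "real ^ 'd \<Rightarrow> real ^ 'm"
    assume pos: "\<forall>t\<in>{0..1}. lin_sched b m t > 0" and bM: "M \<le> b"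
      and meas: "\<phi> \<in> borel_measurable borel" and L: "0 \<le> L"
      and lip: "\<forall>t\<in>{t_min b m M..1}. \<forall>t'\<in>{t_min b m M..1}. AE \<omega> in \<Omega>.
               norm (\<phi> (diffused b m x\<^sub>a\<^sub>d\<^sub>v (\<epsilon> \<omega>) t) - \<phi> (diffused b m x\<^sub>a\<^sub>d\<^sub>v (\<epsilon> \<omega>) t'))
               \<le> L * norm (diffused b m x\<^sub>a\<^sub>d\<^sub>v (\<epsilon> \<omega>) t - diffused b m x\<^sub>a\<^sub>d\<^sub>v (\<epsilon> \<omega>) t')"
    have bm: "b > 0" "m > 0"
      using pos[rule_format, of 0] pos[rule_format, of 1] by (auto simp: lin_sched_def)
    have tm: "t_min b m M \<ge> 0"
      using M0 bM bm by (intro t_min_nonneg) auto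
    \<comment> \<open>The threshold keeps \<open>(m - b) * \<delta>\<close> below \<open>b\<close>,
      a lower bound of an increasing schedule; for a decreasing one the left side is nonpositive.
      The 1 in the denominator covers a constant schedule.\<close>
    have small: "(m - b) * \<delta> \<le> 2 * lin_sched b m t"
      if "0 < \<delta>" "\<delta> < b / (\<bar>m - b\<bar> + 1)" "0 \<le> t" "t \<le> 1" for \<delta> t
    proof (cases "m \<ge> b")
      case True
      have "(m - b) * \<delta> \<le> (\<bar>m - b\<bar> + 1) * \<delta>"
        using that by (intro mult_right_mono) auto
      also have "\<dots> \<le> b"
        using that by (simp add: field_simps)
      also have "\<dots> \<le> 2 * lin_sched b m t"
        using that True bm by (simp add: lin_sched_def)
      finally show ?thesis .
    next
      case False
      then have "(m - b) * \<delta> \<le> 0"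
        using that by (simp add: mult_nonpos_nonneg)
      also have "0 \<le> 2 * lin_sched b m t"
        using pos that by (simp add: less_imp_le)
      finally show ?thesis .
    qed
    show "\<exists>\<delta>\<^sub>0>0. \<forall>\<delta>\<in>{0<..<\<delta>\<^sub>0}. \<forall>t\<in>{t_min b m M..1 - \<delta>}.
               integrable \<Omega> (\<lambda>\<omega>. norm (\<phi> (diffused b m x\<^sub>a\<^sub>d\<^sub>v (\<epsilon> \<omega>) t)
                                    - \<phi> (diffused b m x\<^sub>a\<^sub>d\<^sub>v (\<epsilon> \<omega>) (t + \<delta>)))) \<and>
               ereal (expectation (\<lambda>\<omega>. norm (\<phi> (diffused b m x\<^sub>a\<^sub>d\<^sub>v (\<epsilon> \<omega>) t)
                             - \<phi> (diffused b m x\<^sub>a\<^sub>d\<^sub>v (\<epsilon> \<omega>) (t + \<delta>)))))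
               \<le> ereal (C * (L * \<delta>)) * rate b m t"
    proof (rule exI[of _ "b / (\<bar>m - b\<bar> + 1)"], rule conjI, goal_cases)
      case 1
      show ?case using bm by simp
    next
      case 2
      show ?case
        using tm by (intro ballI step pos meas L small lip[rule_format]) auto
    qed
  next
    fix b m :: real
    assume "M \<le> b" "0 < b" "b < m"
    \<comment> \<open>As the starting time is nonnegative, the claim is a restriction of the strict
      decrease on the half-line.\<close>
    then show "strict_antimono_on {t_min b m M..<1} (rate b m)"
      using M0 t_min_nonneg[of M b m]
      by (intro monotone_on_subset[OF rate_strict_antimono]) auto
  qed
qed

end
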